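(* Let $V$ be a set of $m$ elements, $f\colon 2^V\to\mathbb{Z}^+$ a monotone nondecreasing submodular function, $c\colon V\to\mathbb{R}^+$ a cost function with $c(A)=\sum_{v\in A}c(v)$, and $k\le f(V)$ a positive integer. Let $\Delta=\max_{v\in V}f(v)$, $c_{\max}=\max_{v\in V}c(v)$, $c_{\min}=\min_{v\in V}c(v)$, and for a constant $0<\varepsilon<1/4$ let $T=\log_{1/(1-\varepsilon)}(k c_{\max}/c_{\min})$. There is a randomized algorithm with value-oracle access to $f$ that, with probability at least $1-3\varepsilon$, outputs a set $B\subseteq V$ with $f(B)\ge k$ and $$c(B)\le \frac{H(\min\{\Delta,k\})}{1-4\varepsilon}\cdot\min\{c(A)\colon A\subseteq V,\ f(A)\ge k\},$$ and which takes at most $O\!\left(\frac{T\log k(\log m+\log(T\log k))}{\varepsilon^3}\right)$ adaptive rounds.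
   Context: This is the minimum cost submodular cover problem (MinSMC): find $A\subseteq V$ of minimum cost $c(A)$ such that $f(A)\ge k$. $f$ is submodular if $f(S)+f(T)\ge f(S\cap T)+f(S\cup T)$ for all $S,T\subseteq V$, monotone nondecreasing if $f(S)\le f(T)$ for $S\subseteq T$. $H(n)=\sum_{i=1}^n 1/i$ is the $n$-th Harmonic number. Adaptive rounds: given a value oracle for $f$ that receives a set $S$ and returns $f(S)$, an algorithm takes $\gamma$ adaptive rounds if every query to the oracle in round $i\in\{1,\dots,\gamma\}$ depends only on the answers to queries in rounds $1$ to $i-1$, and it performs polynomially many parallel queries in each round.
   Formalization: For k = 1 the round bound contains log(T log k) = log 0 and is undefined (read as 0 rounds, the claim is false); the O(X) bound is therefore stated as a constant times max{1, X}, which changes nothing for k ≥ 2. *)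

theory Defs
  imports "HOL-Probability.Probability" "HOL-Computational_Algebra.Polynomial"
begin

definition submodular_on :: "'a set \<Rightarrow> ('a set \<Rightarrow> nat) \<Rightarrow> bool" where
  "submodular_on V f \<longleftrightarrow>
     (\<forall>S\<subseteq>V. \<forall>T\<subseteq>V. f S + f T \<ge> f (S \<inter> T) + f (S \<union> T))"

definition cost :: "('a \<Rightarrow> real) \<Rightarrow> 'a set \<Rightarrow> real" where
  "cost c A = (\<Sum>v\<in>A. c v)"

definition minsmc_opt :: "'a set \<Rightarrow> ('a set \<Rightarrow> nat) \<Rightarrow> ('a \<Rightarrow> real) \<Rightarrow> nat \<Rightarrow> real" where
  "minsmc_opt V f c k = Min (cost c ` {A. A \<subseteq> V \<and> f A \<ge> k})"

text \<open>
  Randomized algorithms with access to a value oracle for a set function.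
  \<open>Query Q next\<close> is one adaptive round: the sets in \<open>Q\<close> are submitted in parallel and
  \<open>next\<close> continues with their values. \<open>Toss\<close> draws the continuation at random.
  The oracle is not part of the algorithm; only \<open>run\<close> below has access to it.
\<close>

datatype 'a oracle_alg =
    Output "'a set"
  | Toss "'a oracle_alg pmf"
  | Query "'a set set" "('a set \<Rightarrow> nat) \<Rightarrow> 'a oracle_alg"

text \<open>
  The distribution of the list of query batches (one per adaptive round) together with the
  output. A continuation receives \<open>restrict f Q\<close>, that is, no information on \<open>f\<close> outside
  the batch \<open>Q\<close>; hence a batch depends only on coin tosses and on answers of earlier rounds.
\<close>

primrec run :: "('a set \<Rightarrow> nat) \<Rightarrow> 'a oracle_alg \<Rightarrow> ('a set set list \<times> 'a set) pmf" where
  "run f (Output B) = return_pmf ([], B)"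
| "run f (Toss p) = join_pmf (map_pmf (run f) p)"
| "run f (Query Q next) =
     map_pmf (\<lambda>(Qs, B). (Q # Qs, B)) (run f (next (restrict f Q)))"

lemma run_Toss_bind: "run f (Toss p) = bind_pmf p (run f)"
  by (simp add: bind_eq_join_pmf)

text \<open>
  Worst case over all coin tosses: at most \<open>\<gamma>\<close> adaptive rounds, with at most \<open>q\<close> queries in
  each round, all of them to subsets of the ground set.
\<close>

definition takes_rounds ::
    "'a set \<Rightarrow> ('a set \<Rightarrow> nat) \<Rightarrow> 'a oracle_alg \<Rightarrow> real \<Rightarrow> nat \<Rightarrow> bool" where
  "takes_rounds V f A \<gamma> q \<longleftrightarrow>
     (\<forall>(Qs, B) \<in> set_pmf (run f A).
        real (length Qs) \<le> \<gamma> \<and> (\<forall>Q\<in>set Qs. Q \<subseteq> Pow V \<and> card Q \<le> q))"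

definition output_prob :: "('a set \<Rightarrow> nat) \<Rightarrow> 'a oracle_alg \<Rightarrow> ('a set \<Rightarrow> bool) \<Rightarrow> real" where
  "output_prob f A P = measure_pmf.prob (run f A) {(Qs, B). P B}"

definition minsmc_T :: "'a set \<Rightarrow> ('a \<Rightarrow> real) \<Rightarrow> nat \<Rightarrow> real \<Rightarrow> real" where
  "minsmc_T V c k \<epsilon> = log (1 / (1 - \<epsilon>)) (real k * Max (c ` V) / Min (c ` V))"

text \<open>
  The expression under the \<open>O\<close> of the round bound, with logarithms to base 2. For
  \<open>k \<ge> 2\<close>, \<open>m \<ge> 1\<close> and \<open>0 < \<epsilon> < 1/4\<close> it exceeds 1, since \<open>T \<ge> log (4/3) 2 > 2\<close>. For
  \<open>k = 1\<close> it degenerates to 0, although the oracle still has to be queried in general; one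
  therefore has to bound the rounds by a multiple of its maximum with 1.
\<close>

definition round_bound :: "real \<Rightarrow> nat \<Rightarrow> nat \<Rightarrow> real \<Rightarrow> real" where
  "round_bound T k m \<epsilon> =
     T * log 2 (real k) * (log 2 (real m) + log 2 (T * log 2 (real k))) / \<epsilon> ^ 3"

end

theory Submission
  imports Defs
begin

text \<open>
  Parallel threshold greedy for \<open>g = min k f\<close>. The density threshold \<open>\<tau>\<close> runs through
  \<open>(1 - \<epsilon>)\<^sup>j k / c\<^sub>m\<^sub>i\<^sub>n\<close> for \<open>j \<le> \<lceil>T\<rceil>\<close>. In each phase let \<open>A\<close> be the set of elements
  with gain at least \<open>\<tau> c v\<close>; a uniformly random permutation of \<open>A\<close> is added element by
  element until the cost of those elements of \<open>A\<close> that are still dense has dropped by the factor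
  \<open>1 + \<epsilon>\<^sup>2\<close>. This prefix is found with one batch of queries. The cost of \<open>A\<close> lies between
  \<open>(1 - \<epsilon>) / \<tau>\<close> and \<open>m k / \<tau>\<close>, so \<open>O(log (m k) / \<epsilon>\<^sup>2)\<close> phases exhaust a threshold,
  whatever the coin tosses.

  An element that is dense when it is added is an approximately greedy choice, and the total cost of
  these elements is bounded by Wolsey's dual fitting argument, in the form of a potential. The other
  elements have expected cost at most \<open>\<epsilon>\<^sup>2\<close> times the drop of the potential, since the
  sampling is uniform and the stopping rule weighs elements by cost; Markov's inequality for the excess of
  the total cost over the initial potential finishes the proof. For \<open>k = 1\<close>, where the
  round bound degenerates, the cheapest single element of positive value is optimal.
\<close>

section \<open>The algorithm and its query batches\<close>

text \<open>Marginal gain of the truncation \<open>min k r\<close>. The answers \<open>r\<close> are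
  a parameter because the algorithm only ever sees a restriction of the oracle; for \<open>f\<close>
  itself the subtraction on \<open>nat\<close> loses nothing, see \<open>gain_real\<close>.\<close>

definition gain :: "('a set \<Rightarrow> nat) \<Rightarrow> nat \<Rightarrow> 'a set \<Rightarrow> 'a \<Rightarrow> nat" where
  "gain r k S v = min k (r (insert v S)) - min k (r S)"

definition dense_elems ::
    "'a set \<Rightarrow> ('a \<Rightarrow> real) \<Rightarrow> ('a set \<Rightarrow> nat) \<Rightarrow> nat \<Rightarrow> real \<Rightarrow> 'a set \<Rightarrow> 'a set" where
  "dense_elems A c r k \<tau> S = {v \<in> A. \<tau> * c v \<le> real (gain r k S v)}"

text \<open>The test precedes each insertion and always refers to the full set \<open>A\<close>.
  Hence an element is added only while the dense part of \<open>A\<close> still carries almost all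
  of its cost, and whenever the test stops the process, that cost has dropped by the factor
  \<open>1 + \<eta>\<close>.\<close>

primrec add_prefix ::
    "('a set \<Rightarrow> nat) \<Rightarrow> ('a \<Rightarrow> real) \<Rightarrow> nat \<Rightarrow> real \<Rightarrow> real \<Rightarrow> 'a set \<Rightarrow> 'a set \<Rightarrow> 'a list \<Rightarrow> 'a set" where
  "add_prefix r c k \<eta> \<tau> A S [] = S"
| "add_prefix r c k \<eta> \<tau> A S (x # xs) =
     (if cost c A \<le> (1 + \<eta>) * cost c (dense_elems A c r k \<tau> S)
      then add_prefix r c k \<eta> \<tau> A (insert x S) xs else S)"

text \<open>All values that \<open>add_prefix\<close> can read: every prefix, and every prefix
  extended by one element. The empty set among the extensions yields the prefixes
  themselves.\<close>

definition batch :: "'a set \<Rightarrow> 'a set \<Rightarrow> 'a list \<Rightarrow> 'a set set" where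
  "batch V S xs =
     (\<lambda>(i, B). S \<union> set (take i xs) \<union> B) ` ({..length xs} \<times> insert {} ((\<lambda>v. {v}) ` V))"

text \<open>Here \<open>n\<close> counts the thresholds still to come, \<open>t\<close> the phases
  left at the present one, and \<open>t0\<close> the phases per threshold. There is no early exit,
  so the number of rounds does not depend on the coin tosses. The first batch of a phase determines
  the dense set; only then can the permutation be drawn and its prefixes be queried.\<close>

fun threshold_alg ::
    "'a set \<Rightarrow> ('a \<Rightarrow> real) \<Rightarrow> nat \<Rightarrow> real \<Rightarrow> nat \<Rightarrow> nat \<Rightarrow> nat \<Rightarrow> real \<Rightarrow> 'a set \<Rightarrow> 'a oracle_alg" where
  "threshold_alg V c k \<epsilon> t0 0 0 \<tau> S = Output S"
| "threshold_alg V c k \<epsilon> t0 (Suc n) 0 \<tau> S = threshold_alg V c k \<epsilon> t0 n t0 ((1 - \<epsilon>) * \<tau>) S"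
| "threshold_alg V c k \<epsilon> t0 n (Suc t) \<tau> S =
     Query (batch V S []) (\<lambda>r. Toss (map_pmf
       (\<lambda>xs. Query (batch V S xs)
          (\<lambda>r'. threshold_alg V c k \<epsilon> t0 n t \<tau>
             (add_prefix r' c k (\<epsilon>\<^sup>2) \<tau> (dense_elems V c r k \<tau> S) S xs)))
       (pmf_of_set (permutations_of_set (dense_elems V c r k \<tau> S)))))"

text \<open>Follows the recursion of \<open>threshold_alg\<close> on its two counters alone, so that
  \<open>\<tau>\<close> and \<open>S\<close> can be generalised; \<open>t0\<close> is the value to
  which \<open>t\<close> is reset.\<close>

lemma threshold_induct [case_names stop lower phase]:
  assumes "P 0 0"
    and "\<And>n. P n t0 \<Longrightarrow> P (Suc n) 0"
    and "\<And>n t. P n t \<Longrightarrow> P n (Suc t)"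
  shows "P n (t :: nat)"
proof (induction n arbitrary: t)
  case 0
  show ?case by (induction t) (use assms in auto)
next
  case (Suc n)
  show ?case by (induction t) (use assms Suc in auto)
qed

section \<open>Locality: the queried values determine a phase\<close>

lemma dense_elems_subset: "dense_elems A c r k \<tau> S \<subseteq> A"
  by (auto simp: dense_elems_def)

lemma dense_elems_cong:
  assumes "r S = r' S" "\<And>v. v \<in> A \<Longrightarrow> r (insert v S) = r' (insert v S)"
  shows "dense_elems A c r k \<tau> S = dense_elems A c r' k \<tau> S"
  using assms by (auto simp: dense_elems_def gain_def)

lemma add_prefix_cong:
  assumes "\<And>i v. i \<le> length xs \<Longrightarrow> v \<in> A \<Longrightarrow>
      r (S \<union> set (take i xs)) = r' (S \<union> set (take i xs)) \<and>
      r (insert v (S \<union> set (take i xs))) = r' (insert v (S \<union> set (take i xs)))"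
  shows "add_prefix r c k \<eta> \<tau> A S xs = add_prefix r' c k \<eta> \<tau> A S xs"
  using assms
proof (induction xs arbitrary: S)
  case (Cons x xs)
  have "add_prefix r c k \<eta> \<tau> A (insert x S) xs = add_prefix r' c k \<eta> \<tau> A (insert x S) xs"
  proof (rule Cons.IH)
    fix i v assume "i \<le> length xs" "v \<in> A"
    thus "r (insert x S \<union> set (take i xs)) = r' (insert x S \<union> set (take i xs)) \<and>
      r (insert v (insert x S \<union> set (take i xs))) = r' (insert v (insert x S \<union> set (take i xs)))"
      using Cons.prems[of "Suc i" v] by simp
  qed
  moreover have "dense_elems A c r k \<tau> S = dense_elems A c r' k \<tau> S"
    using Cons.prems[of 0] by (auto simp: dense_elems_def gain_def)
  ultimately show ?case by simp
qed simp

lemma batch_memI: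
  assumes "i \<le> length xs"
  shows "S \<union> set (take i xs) \<in> batch V S xs"
    and "v \<in> V \<Longrightarrow> insert v (S \<union> set (take i xs)) \<in> batch V S xs"
  using assms unfolding batch_def by (force simp: image_iff)+

lemma batch_subset_Pow:
  assumes "S \<subseteq> V" "set xs \<subseteq> V"
  shows "batch V S xs \<subseteq> Pow V"
  using assms set_take_subset[of _ xs] unfolding batch_def by fastforce

lemma card_batch_le:
  assumes "finite V" "length xs \<le> card V"
  shows "card (batch V S xs) \<le> (card V + 1) * (card V + 1)"
proof -
  have "card (insert {} ((\<lambda>v. {v}) ` V)) \<le> card V + 1"
    using card_image_le[OF assms(1), of "\<lambda>v. {v}"]
    by (simp add: card_insert_if assms(1))
  hence "card ({..length xs} \<times> insert {} ((\<lambda>v. {v}) ` V)) \<le> (card V + 1) * (card V + 1)"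
    unfolding card_cartesian_product using assms(2) by (intro mult_mono) auto
  moreover have "card (batch V S xs) \<le> card ({..length xs} \<times> insert {} ((\<lambda>v. {v}) ` V))"
    unfolding batch_def by (rule card_image_le) (use assms in auto)
  ultimately show ?thesis by linarith
qed

text \<open>The batch at \<open>S\<close> determines the dense set, and the batch of prefixes
  determines every test of \<open>add_prefix\<close>; hence the restricted answers may be replaced
  by \<open>f\<close>. Later arguments about a phase start from this form.\<close>

lemma run_threshold_alg_Suc:
  fixes f :: "'a set \<Rightarrow> nat" and V S :: "'a set" and c :: "'a \<Rightarrow> real" and k :: nat and \<tau> :: real
  assumes "finite V"
  defines "A \<equiv> dense_elems V c f k \<tau> S"
  shows "run f (threshold_alg V c k \<epsilon> t0 n (Suc t) \<tau> S) =
    bind_pmf (pmf_of_set (permutations_of_set A)) (\<lambda>xs.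
      map_pmf (\<lambda>(Qs, B). (batch V S [] # batch V S xs # Qs, B))
        (run f (threshold_alg V c k \<epsilon> t0 n t \<tau> (add_prefix f c k (\<epsilon>\<^sup>2) \<tau> A S xs))))"
proof -
  have A: "dense_elems V c (restrict f (batch V S [])) k \<tau> S = A"
    unfolding A_def using batch_memI[where i = 0 and xs = "[]" and S = S and V = V]
    by (intro dense_elems_cong) auto
  have "A \<subseteq> V" by (simp add: A_def dense_elems_subset)
  hence B: "add_prefix (restrict f (batch V S xs)) c k (\<epsilon>\<^sup>2) \<tau> A S xs = add_prefix f c k (\<epsilon>\<^sup>2) \<tau> A S xs" for xs
    using batch_memI[where xs = xs and S = S and V = V]
    by (intro add_prefix_cong) (auto simp del: Un_insert_left Un_insert_right)
  show ?thesis
    by (simp add: A B bind_map_pmf map_bind_pmf map_pmf_comp split_def bind_eq_join_pmf[symmetric])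
qed

text \<open>The right side is a sum of \<open>y - y'\<close> reciprocals, each at least
  \<open>1 / y\<close>.\<close>

lemma harm_diff_ge:
  assumes "y' \<le> y" "0 < y"
  shows "(real y - real y') / real y \<le> harm y - harm y'"
proof -
  have "real d / real (y' + d) \<le> harm (y' + d) - harm y'" for d
  proof (induction d)
    case (Suc d)
    have "real (Suc d) / real (y' + Suc d) = real d / real (y' + Suc d) + 1 / real (y' + Suc d)"
      by (simp add: add_divide_distrib)
    also have "real d / real (y' + Suc d) \<le> real d / real (y' + d)"
      by (cases "d = 0") (auto intro!: divide_left_mono)
    finally show ?case using Suc by (simp add: harm_Suc inverse_eq_divide)
  qed (auto)
  from this[of "y - y'"] assms show ?thesis by (simp add: of_nat_diff)
qed

section \<open>Gains and costs of a fixed instance\<close>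

locale minsmc =
  fixes V :: "'a set" and c :: "'a \<Rightarrow> real" and k :: nat and \<epsilon> :: real and f :: "'a set \<Rightarrow> nat"
  assumes finite_V: "finite V" and nonempty_V: "V \<noteq> {}"
    and mono_f: "mono_on (Pow V) f" and submodular_f: "submodular_on V f"
    and c_pos: "v \<in> V \<Longrightarrow> 0 < c v"
    and k_pos: "1 \<le> k" and k_le: "k \<le> f V"
    and eps_pos: "0 < \<epsilon>" and eps_less: "\<epsilon> < 1 / 4"
begin

abbreviation "gn \<equiv> gain f k"
abbreviation "dense \<equiv> dense_elems V c f k"

lemma f_mono: "S \<subseteq> S' \<Longrightarrow> S' \<subseteq> V \<Longrightarrow> f S \<le> f S'"
  using mono_f by (auto simp: mono_on_def)

lemma gain_real:
  assumes "S \<subseteq> V" "v \<in> V"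
  shows "real (gn S v) = real (min k (f (insert v S))) - real (min k (f S))"
proof -
  have "min k (f S) \<le> min k (f (insert v S))"
    using f_mono[OF subset_insertI, of v S] assms by (intro min.mono) auto
  thus ?thesis unfolding gain_def by (rule of_nat_diff)
qed

lemma gain_mem: "v \<in> S \<Longrightarrow> gn S v = 0"
  by (simp add: gain_def insert_absorb)

lemma gain_le: "gn S v \<le> k"
  by (simp add: gain_def)

text \<open>Diminishing returns survive truncation at \<open>k\<close>. For \<open>v\<close> outside
  \<open>S'\<close>, submodularity is applied to \<open>insert v S\<close> and \<open>S'\<close>;
  the minima are then resolved by cases, which uses monotonicity.\<close>

lemma gain_antimono:
  assumes "S \<subseteq> S'" "S' \<subseteq> V" "v \<in> V"
  shows "gn S' v \<le> gn S v"
proof (cases "v \<in> S'")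
  case False
  have "f (insert v S \<inter> S') + f (insert v S \<union> S') \<le> f (insert v S) + f S'"
    using submodular_f assms unfolding submodular_on_def by (metis insert_subset order_trans)
  moreover have "insert v S \<inter> S' = S" "insert v S \<union> S' = insert v S'"
    using assms False by auto
  ultimately have "f S + f (insert v S') \<le> f (insert v S) + f S'" by simp
  moreover have "f S \<le> f (insert v S)" "f S \<le> f S'" "f S' \<le> f (insert v S')"
    using assms by (auto intro!: f_mono)
  ultimately show ?thesis unfolding gain_def by linarith
qed (simp add: gain_mem)

text \<open>Adding the elements of \<open>U\<close> one at a time telescopes the left side, and each
  increment is at most the gain at \<open>S\<close>.\<close>

lemma residual_le:
  assumes "U \<subseteq> V" "S \<subseteq> V"
  shows "real (min k (f (S \<union> U))) - real (min k (f S)) \<le> (\<Sum>u\<in>U. real (gn S u))"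
proof -
  have "finite U" using assms finite_V finite_subset by blast
  thus ?thesis using assms(1)
  proof (induction U)
    case (insert u U)
    have "real (gn (S \<union> U) u) \<le> real (gn S u)"
      using insert assms by (intro of_nat_mono gain_antimono) auto
    moreover have "real (gn (S \<union> U) u) = real (min k (f (S \<union> insert u U))) - real (min k (f (S \<union> U)))"
      using insert assms by (subst gain_real) auto
    ultimately show ?case using insert by simp
  qed simp
qed

lemma cost_pos: "A \<subseteq> V \<Longrightarrow> A \<noteq> {} \<Longrightarrow> 0 < cost c A"
  unfolding cost_def using finite_V finite_subset c_pos by (intro sum_pos) auto

lemma cost_nonneg: "A \<subseteq> V \<Longrightarrow> 0 \<le> cost c A"
  unfolding cost_def using c_pos by (intro sum_nonneg) (auto intro: less_imp_le)

lemma cost_mono: "A \<subseteq> B \<Longrightarrow> B \<subseteq> V \<Longrightarrow> cost c A \<le> cost c B"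
  unfolding cost_def using c_pos finite_V finite_subset[of B V]
  by (intro sum_mono2) (auto intro: less_imp_le)

lemma eps_sq: "0 < 1 + \<epsilon>\<^sup>2" "0 < \<epsilon>\<^sup>2"
  using eps_pos by (auto intro: add_pos_pos)

lemma add_prefix_between:
  "S \<subseteq> add_prefix f c k \<eta> \<tau> A S xs \<and> add_prefix f c k \<eta> \<tau> A S xs \<subseteq> S \<union> set xs"
  by (induction xs arbitrary: S) (auto, blast+)

text \<open>If a test fails, its negation is the claim. If the list runs out, all of
  \<open>A\<close> has been added, so every gain on \<open>A\<close> is 0, nothing is dense, and the
  left side vanishes.\<close>

lemma add_prefix_shrinks:
  assumes "A \<subseteq> V" "A \<noteq> {}" "0 < \<tau>" "S \<subseteq> V" "set xs \<subseteq> V" "A \<subseteq> S \<union> set xs"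
  shows "(1 + \<epsilon>\<^sup>2) * cost c (dense_elems A c f k \<tau> (add_prefix f c k (\<epsilon>\<^sup>2) \<tau> A S xs)) < cost c A"
  using assms(4-)
proof (induction xs arbitrary: S)
  case Nil
  have "dense_elems A c f k \<tau> S = {}"
  proof -
    have "\<not> \<tau> * c v \<le> real (gn S v)" if "v \<in> A" for v
      using Nil that c_pos[of v] assms by (auto simp: gain_mem not_le subset_iff)
    thus ?thesis by (auto simp: dense_elems_def)
  qed
  thus ?case using cost_pos[of A] assms by (simp add: cost_def)
next
  case (Cons x xs)
  thus ?case using Cons.IH[of "insert x S"] by auto
qed

section \<open>Invariants of the phases\<close>

text \<open>No element has density above \<open>\<tau> / (1 - \<epsilon>)\<close>, so an element of
  density at least \<open>\<tau>\<close> is a greedy choice up to the factor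
  \<open>1 - \<epsilon>\<close>.\<close>

definition admissible :: "real \<Rightarrow> 'a set \<Rightarrow> bool" where
  "admissible \<tau> S \<longleftrightarrow> S \<subseteq> V \<and> 0 < \<tau> \<and> (\<forall>v\<in>V. (1 - \<epsilon>) * real (gn S v) \<le> \<tau> * c v)"

lemma admissible_mono:
  assumes "admissible \<tau> S" "S \<subseteq> S'" "S' \<subseteq> V"
  shows "admissible \<tau> S'"
  unfolding admissible_def
proof (intro conjI ballI)
  fix v assume "v \<in> V"
  hence "(1 - \<epsilon>) * real (gn S' v) \<le> (1 - \<epsilon>) * real (gn S v)"
    using gain_antimono[OF assms(2,3)] eps_less by (intro mult_left_mono) auto
  thus "(1 - \<epsilon>) * real (gn S' v) \<le> \<tau> * c v"
    using assms(1) \<open>v \<in> V\<close> unfolding admissible_def by (meson order_trans)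
qed (use assms in \<open>simp_all add: admissible_def\<close>)

text \<open>
  The conjunct on \<open>cost\<close> forces \<open>dense \<tau> S\<close> to be empty for \<open>t = 0\<close>, because every
  element of \<open>dense \<tau> S\<close> has gain at least 1 and hence costs at least \<open>(1 - \<epsilon>) / \<tau>\<close>.
\<close>
definition ready :: "nat \<Rightarrow> nat \<Rightarrow> real \<Rightarrow> 'a set \<Rightarrow> bool" where
  "ready n t \<tau> S \<longleftrightarrow> admissible \<tau> S \<and>
     \<tau> * cost c (dense \<tau> S) < (1 - \<epsilon>) * (1 + \<epsilon>\<^sup>2) ^ t \<and>
     (\<forall>v\<in>V. (1 - \<epsilon>) ^ n * \<tau> * c v \<le> 1)"

lemma readyD:
  assumes "ready n t \<tau> S"
  shows "admissible \<tau> S" "S \<subseteq> V" "0 < \<tau>"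
    and "\<And>v. v \<in> V \<Longrightarrow> (1 - \<epsilon>) * real (gn S v) \<le> \<tau> * c v"
    and "\<tau> * cost c (dense \<tau> S) < (1 - \<epsilon>) * (1 + \<epsilon>\<^sup>2) ^ t"
    and "\<And>v. v \<in> V \<Longrightarrow> (1 - \<epsilon>) ^ n * \<tau> * c v \<le> 1"
  using assms unfolding ready_def admissible_def by blast+

lemma ready_0_dense:
  assumes "ready n 0 \<tau> S"
  shows "dense \<tau> S = {}"
proof (rule ccontr)
  note rd = readyD[OF assms]
  assume "dense \<tau> S \<noteq> {}"
  then obtain v where v: "v \<in> dense \<tau> S" by blast
  have "v \<in> V" using v by (simp add: dense_elems_def)
  have "0 < \<tau> * c v" using rd(3) c_pos[OF \<open>v \<in> V\<close>] by simp
  moreover have "\<tau> * c v \<le> real (gn S v)" using v by (simp add: dense_elems_def)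
  ultimately have "1 \<le> gn S v" by linarith
  hence "(1 - \<epsilon>) * 1 \<le> (1 - \<epsilon>) * real (gn S v)"
    using eps_less by (intro mult_left_mono) auto
  hence "1 - \<epsilon> \<le> \<tau> * c v" using rd(4)[OF \<open>v \<in> V\<close>] by (metis mult.right_neutral order_trans)
  moreover have "cost c {v} \<le> cost c (dense \<tau> S)"
    by (rule cost_mono) (use v in \<open>auto simp: dense_elems_def\<close>)
  hence "\<tau> * c v \<le> \<tau> * cost c (dense \<tau> S)"
    using rd(3) by (simp add: cost_def)
  moreover have "\<tau> * cost c (dense \<tau> S) < 1 - \<epsilon>" using rd(5) by simp
  ultimately show False by (meson leD order_trans)
qed

text \<open>At the last threshold \<open>\<tau> * c v \<le> 1\<close>, so by integrality any element
  of nonzero gain would be dense. As none is dense, all gains vanish, and \<open>residual_le\<close>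
  with \<open>U = V\<close> leaves no residual.\<close>

lemma feasible_if_ready:
  assumes "ready 0 0 \<tau> S"
  shows "k \<le> f S"
proof -
  have "gn S v = 0" if "v \<in> V" for v
  proof (rule ccontr)
    assume "gn S v \<noteq> 0"
    hence "1 \<le> real (gn S v)" by simp
    moreover have "\<tau> * c v \<le> 1" using readyD(6)[OF assms that] by simp
    ultimately have "v \<in> dense \<tau> S" using that by (simp add: dense_elems_def)
    thus False using ready_0_dense[OF assms] by simp
  qed
  hence "real (min k (f (S \<union> V))) - real (min k (f S)) \<le> 0"
    using residual_le[of V S] readyD(2)[OF assms] by simp
  moreover have "S \<union> V = V" using readyD(2)[OF assms] by auto
  ultimately show ?thesis using k_le by simp
qed

text \<open>By \<open>gain_antimono\<close> no element becomes dense during a phase, so it suffices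
  to look at the dense part of the old set \<open>A\<close>, which \<open>add_prefix_shrinks\<close>
  controls.\<close>

lemma ready_phase:
  assumes "ready n (Suc t) \<tau> S" "set xs = dense \<tau> S"
  shows "ready n t \<tau> (add_prefix f c k (\<epsilon>\<^sup>2) \<tau> (dense \<tau> S) S xs)"
proof -
  define A where "A = dense \<tau> S"
  define S' where "S' = add_prefix f c k (\<epsilon>\<^sup>2) \<tau> A S xs"
  have AV: "A \<subseteq> V" by (simp add: A_def dense_elems_subset)
  have SV: "S \<subseteq> V" and \<tau>: "0 < \<tau>" and adm: "admissible \<tau> S"
    using readyD[OF assms(1)] by blast+
  have S': "S \<subseteq> S'" "S' \<subseteq> V"
    using add_prefix_between[of S "\<epsilon>\<^sup>2" \<tau> A xs] SV AV assms(2) by (auto simp: S'_def A_def)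
  have sub: "dense \<tau> S' = dense_elems A c f k \<tau> S'"
  proof -
    have "v \<in> A" if "v \<in> dense \<tau> S'" for v
      using that gain_antimono[OF S', of v] by (auto simp: dense_elems_def A_def)
    thus ?thesis using AV by (auto simp: dense_elems_def)
  qed
  have "\<tau> * cost c (dense \<tau> S') < (1 - \<epsilon>) * (1 + \<epsilon>\<^sup>2) ^ t"
  \<comment> \<open>The strict decrease fails for empty \<open>A\<close>, but then the left side is
    0.\<close>
  proof (cases "A = {}")
    case True
    thus ?thesis unfolding sub using eps_less zero_less_power[OF eps_sq(1), of t]
      by (simp add: dense_elems_def cost_def)
  next
    case False
    have "(1 + \<epsilon>\<^sup>2) * cost c (dense \<tau> S') < cost c A"
      unfolding sub unfolding S'_def using AV False \<tau> SV assms(2)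
      by (intro add_prefix_shrinks) (auto simp: A_def)
    hence "\<tau> * ((1 + \<epsilon>\<^sup>2) * cost c (dense \<tau> S')) < \<tau> * cost c A"
      using \<tau> by simp
    also have "\<dots> < (1 - \<epsilon>) * (1 + \<epsilon>\<^sup>2) ^ Suc t" using readyD(5)[OF assms(1)] by (simp add: A_def)
    finally have "(1 + \<epsilon>\<^sup>2) * (\<tau> * cost c (dense \<tau> S')) < (1 + \<epsilon>\<^sup>2) * ((1 - \<epsilon>) * (1 + \<epsilon>\<^sup>2) ^ t)"
      by (simp add: mult_ac)
    thus ?thesis using eps_sq mult_less_cancel_left_pos by blast
  qed
  moreover have "admissible \<tau> S'" using admissible_mono[OF adm S'] .
  ultimately show ?thesis using readyD(6)[OF assms(1)] unfolding ready_def S'_def A_def by blast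
qed

text \<open>A dense element costs at most \<open>k / \<tau>\<close>, since no gain exceeds
  \<open>k\<close>.\<close>

lemma ready_start:
  assumes "admissible \<tau> S" "\<forall>v\<in>V. (1 - \<epsilon>) ^ n * \<tau> * c v \<le> 1"
    and "real (card V) * real k < (1 - \<epsilon>) * (1 + \<epsilon>\<^sup>2) ^ t"
  shows "ready n t \<tau> S"
proof -
  have "\<tau> * cost c (dense \<tau> S) = (\<Sum>v\<in>dense \<tau> S. \<tau> * c v)"
    by (simp add: cost_def sum_distrib_left)
  also have "\<dots> \<le> (\<Sum>v\<in>dense \<tau> S. real k)"
    by (rule sum_mono) (use gain_le in \<open>fastforce simp: dense_elems_def intro: order_trans\<close>)
  also have "\<dots> \<le> real (card V) * real k"
    using card_mono[OF finite_V dense_elems_subset[of V c f k \<tau> S]] by (simp add: mult_right_mono)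
  finally show ?thesis using assms unfolding ready_def by linarith
qed

text \<open>An empty dense set at \<open>\<tau>\<close> says that every gain is below
  \<open>\<tau> * c v\<close>, which multiplied by \<open>1 - \<epsilon>\<close> is admissibility at
  the lowered threshold.\<close>

lemma ready_lower:
  assumes "ready (Suc n) 0 \<tau> S" "real (card V) * real k < (1 - \<epsilon>) * (1 + \<epsilon>\<^sup>2) ^ t"
  shows "ready n t ((1 - \<epsilon>) * \<tau>) S"
proof (rule ready_start)
  have "real (gn S v) \<le> \<tau> * c v" if "v \<in> V" for v
    using ready_0_dense[OF assms(1)] that by (auto simp: dense_elems_def not_le intro: less_imp_le)
  thus "admissible ((1 - \<epsilon>) * \<tau>) S"
    using readyD(2,3)[OF assms(1)] eps_less by (simp add: admissible_def mult.assoc)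
  show "\<forall>v\<in>V. (1 - \<epsilon>) ^ n * ((1 - \<epsilon>) * \<tau>) * c v \<le> 1"
    using readyD(6)[OF assms(1)] by (simp add: mult_ac)
qed (rule assms(2))

text \<open>Feasibility, round count and batch sizes hold for every outcome of the coin tosses; only
  the cost is random. Each of the \<open>t + n * t0\<close> phases takes two rounds, and lowering
  the threshold takes none.\<close>

lemma threshold_alg_support:
  assumes "ready n t \<tau> S" "real (card V) * real k < (1 - \<epsilon>) * (1 + \<epsilon>\<^sup>2) ^ t0"
    and "(Qs, B) \<in> set_pmf (run f (threshold_alg V c k \<epsilon> t0 n t \<tau> S))"
  shows "B \<subseteq> V \<and> k \<le> f B \<and> length Qs = 2 * (t + n * t0) \<and>
    (\<forall>Q\<in>set Qs. Q \<subseteq> Pow V \<and> card Q \<le> (card V + 1) * (card V + 1))"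
  using assms(1,3)
proof (induction n t arbitrary: \<tau> S Qs B rule: threshold_induct[where ?t0.0 = t0])
  case stop
  thus ?case using feasible_if_ready readyD(2) by auto
next
  case (lower n)
  thus ?case using lower.IH[OF ready_lower[OF _ assms(2)]] by auto
next
  case (phase n t)
  define A where "A = dense \<tau> S"
  have AV: "A \<subseteq> V" by (simp add: A_def dense_elems_subset)
  have finA: "finite A" using AV finite_V finite_subset by blast
  from phase.prems(2) obtain xs Qs' where xs: "xs \<in> permutations_of_set A"
    and Qs: "Qs = batch V S [] # batch V S xs # Qs'"
    and run: "(Qs', B) \<in> set_pmf (run f (threshold_alg V c k \<epsilon> t0 n t \<tau>
        (add_prefix f c k (\<epsilon>\<^sup>2) \<tau> A S xs)))"
    unfolding run_threshold_alg_Suc[OF finite_V] A_def[symmetric]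
    by (auto simp: set_pmf_of_set finA)
  have set_xs: "set xs = A" using permutations_of_setD[OF xs] by simp
  have len: "length xs \<le> card V"
    using length_finite_permutations_of_set[OF xs] card_mono[OF finite_V AV] by simp
  have SV: "S \<subseteq> V" using readyD(2)[OF phase.prems(1)] .
  show ?case
    using phase.IH[OF ready_phase[OF phase.prems(1)] run[unfolded A_def]] set_xs Qs
      batch_subset_Pow[OF SV, of xs] batch_subset_Pow[OF SV, of "[]"] AV
      card_batch_le[OF finite_V len, of S] card_batch_le[OF finite_V, of "[]" S]
    by (auto simp: A_def)
qed

section \<open>Dual fitting by a potential\<close>

text \<open>
  With prices \<open>\<theta> = 1 / \<tau>\<close>, Wolsey's bound on the cost that \<open>\<Sum> \<theta>\<^sub>i (g S\<^sub>i\<^sub>+\<^sub>1 - g S\<^sub>i)\<close>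
  still accrues from \<open>S\<close> on, after summation by parts; \<open>U\<close> is a cover to compare with.
\<close>
definition pot :: "'a set \<Rightarrow> real \<Rightarrow> 'a set \<Rightarrow> real" where
  "pot U \<tau> S = (real k - real (min k (f S))) / \<tau> +
     (\<Sum>u\<in>U. c u / (1 - \<epsilon>) * harm (gn S u) - real (gn S u) / \<tau>)"

text \<open>A drop of the gain of \<open>u\<close> from \<open>y\<close> to \<open>y'\<close>,
  charged at price \<open>1 / \<tau>\<close>, is covered by the harmonic term: admissibility bounds
  \<open>y / \<tau>\<close> by \<open>c u / (1 - \<epsilon>)\<close>, and
  \<open>harm_diff_ge\<close> bounds the fraction \<open>(y - y') / y\<close>.\<close>

lemma harm_term:
  assumes "admissible \<tau> S" "u \<in> V" "y' \<le> gn S u"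
  shows "(real (gn S u) - real y') / \<tau> \<le> c u / (1 - \<epsilon>) * (harm (gn S u) - harm y')"
proof (cases "gn S u = 0")
  case False
  define y where "y = gn S u"
  have y: "0 < y" "y' \<le> y" using False assms by (auto simp: y_def)
  have \<tau>: "0 < \<tau>" and adm: "(1 - \<epsilon>) * real y \<le> \<tau> * c u"
    using assms(1,2) by (auto simp: admissible_def y_def)
  have "real y / \<tau> \<le> c u / (1 - \<epsilon>)"
    using adm \<tau> eps_less by (simp add: field_simps)
  hence "real y / \<tau> * ((real y - real y') / real y) \<le> c u / (1 - \<epsilon>) * ((real y - real y') / real y)"
    using y by (intro mult_right_mono) auto
  also have "\<dots> \<le> c u / (1 - \<epsilon>) * (harm y - harm y')"
    using harm_diff_ge[OF y(2,1)] c_pos[OF assms(2)] eps_less by (intro mult_left_mono) auto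
  also have "real y / \<tau> * ((real y - real y') / real y) = (real y - real y') / \<tau>"
    using y by simp
  finally show ?thesis by (simp add: y_def)
qed (use assms in simp)

lemma pot_nonneg:
  assumes "admissible \<tau> S" "U \<subseteq> V"
  shows "0 \<le> pot U \<tau> S"
proof -
  have "0 \<le> c u / (1 - \<epsilon>) * harm (gn S u) - real (gn S u) / \<tau>" if "u \<in> U" for u
    using harm_term[OF assms(1), of u 0] that assms(2) by (auto simp: harm_def)
  hence "0 \<le> (\<Sum>u\<in>U. c u / (1 - \<epsilon>) * harm (gn S u) - real (gn S u) / \<tau>)"
    by (rule sum_nonneg)
  moreover have "0 \<le> (real k - real (min k (f S))) / \<tau>"
    using assms(1) by (intro divide_nonneg_pos) (auto simp: admissible_def)
  ultimately show ?thesis by (simp add: pot_def)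
qed

text \<open>The residual term drops by exactly \<open>gn S x / \<tau>\<close>, and by
  \<open>harm_term\<close> no summand over \<open>U\<close> increases.\<close>

lemma pot_insert:
  assumes "admissible \<tau> S" "U \<subseteq> V" "x \<in> V"
  shows "pot U \<tau> (insert x S) + real (gn S x) / \<tau> \<le> pot U \<tau> S"
proof -
  have SV: "S \<subseteq> V" using assms(1) by (simp add: admissible_def)
  have "(\<Sum>u\<in>U. c u / (1 - \<epsilon>) * harm (gn (insert x S) u) - real (gn (insert x S) u) / \<tau>)
    \<le> (\<Sum>u\<in>U. c u / (1 - \<epsilon>) * harm (gn S u) - real (gn S u) / \<tau>)"
  proof (rule sum_mono)
    fix u assume "u \<in> U"
    hence "u \<in> V" using assms(2) by auto
    have "gn (insert x S) u \<le> gn S u"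
      using SV assms(3) \<open>u \<in> V\<close> by (intro gain_antimono) auto
    from harm_term[OF assms(1) \<open>u \<in> V\<close> this]
    show "c u / (1 - \<epsilon>) * harm (gn (insert x S) u) - real (gn (insert x S) u) / \<tau>
      \<le> c u / (1 - \<epsilon>) * harm (gn S u) - real (gn S u) / \<tau>"
      by (simp add: right_diff_distrib diff_divide_distrib)
  qed
  moreover have "(real k - real (min k (f (insert x S)))) / \<tau> + real (gn S x) / \<tau>
      = (real k - real (min k (f S))) / \<tau>"
    by (subst gain_real[OF SV assms(3)]) (simp add: diff_divide_distrib)
  ultimately show ?thesis by (simp add: pot_def)
qed

lemma residual_le_cover:
  assumes "S \<subseteq> V" "U \<subseteq> V" "k \<le> f U"
  shows "real k - real (min k (f S)) \<le> (\<Sum>u\<in>U. real (gn S u))"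
proof -
  have "k \<le> f (S \<union> U)" using f_mono[of U "S \<union> U"] assms by auto
  thus ?thesis using residual_le[OF assms(2,1)] by simp
qed

text \<open>The part of the potential that depends on \<open>\<tau>\<close> is
  \<open>a / \<tau>\<close> with \<open>a \<le> 0\<close>, because \<open>U\<close> is a cover; a
  smaller \<open>\<tau>\<close> only makes it more negative.\<close>

lemma pot_lower:
  assumes "S \<subseteq> V" "U \<subseteq> V" "k \<le> f U" "0 < \<tau>'" "\<tau>' \<le> \<tau>"
  shows "pot U \<tau>' S \<le> pot U \<tau> S"
proof -
  define a where "a = real k - real (min k (f S)) - (\<Sum>u\<in>U. real (gn S u))"
  have pot: "pot U \<tau> S = a / \<tau> + (\<Sum>u\<in>U. c u / (1 - \<epsilon>) * harm (gn S u))" for \<tau>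
    by (simp add: pot_def a_def sum_subtractf diff_divide_distrib flip: sum_divide_distrib)
  have "a \<le> 0" using residual_le_cover[OF assms(1-3)] by (simp add: a_def)
  hence "a / \<tau>' \<le> a / \<tau>" using assms(4,5) by (intro divide_left_mono_neg) auto
  thus ?thesis by (simp add: pot)
qed

text \<open>The part depending on \<open>\<tau>\<close> is nonpositive and is dropped, so the bound
  does not depend on the initial threshold. The gains at the empty set are at most both
  \<open>k\<close> and the largest singleton value.\<close>

lemma pot_le_harm:
  assumes "U \<subseteq> V" "k \<le> f U" "0 < \<tau>"
  shows "pot U \<tau> {} \<le> harm (min (Max ((\<lambda>v. f {v}) ` V)) k) / (1 - \<epsilon>) * cost c U"
proof -
  have "pot U \<tau> {} \<le> (\<Sum>u\<in>U. c u / (1 - \<epsilon>) * harm (gn {} u))"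
    using divide_right_mono[OF residual_le_cover[of "{}" U], of \<tau>] assms
    by (simp add: pot_def sum_subtractf flip: sum_divide_distrib)
  also have "\<dots> \<le> (\<Sum>u\<in>U. c u / (1 - \<epsilon>) * harm (min (Max ((\<lambda>v. f {v}) ` V)) k))"
  proof (rule sum_mono)
    fix u assume "u \<in> U"
    hence "u \<in> V" using assms by auto
    have "f {u} \<le> Max ((\<lambda>v. f {v}) ` V)" using finite_V \<open>u \<in> V\<close> by (intro Max_ge) auto
    hence "gn {} u \<le> min (Max ((\<lambda>v. f {v}) ` V)) k" unfolding gain_def by linarith
    thus "c u / (1 - \<epsilon>) * harm (gn {} u) \<le> c u / (1 - \<epsilon>) * harm (min (Max ((\<lambda>v. f {v}) ` V)) k)"
      using c_pos[OF \<open>u \<in> V\<close>] eps_less by (intro mult_left_mono harm_mono) auto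
  qed
  also have "\<dots> = harm (min (Max ((\<lambda>v. f {v}) ` V)) k) / (1 - \<epsilon>) * cost c U"
    by (simp add: cost_def sum_distrib_left sum_distrib_right sum_divide_distrib mult_ac)
  finally show ?thesis .
qed

section \<open>Expected cost in excess of the potential\<close>

text \<open>
  A dense element is paid for by the drop of the potential; the remaining elements of \<open>R\<close>
  make up only an \<open>\<epsilon>\<^sup>2\<close>-fraction of the cost of the dense ones.
\<close>
lemma uniform_step:
  assumes "admissible \<tau> S" "U \<subseteq> V" "A \<subseteq> V" "R = A - S" "R \<noteq> {}"
    and "cost c A \<le> (1 + \<epsilon>\<^sup>2) * cost c (dense_elems A c f k \<tau> S)"
  defines "b \<equiv> \<lambda>x. if x \<in> dense_elems A c f k \<tau> S then 0 else c x"
  shows "(\<Sum>x\<in>R. \<epsilon>\<^sup>2 * pot U \<tau> (insert x S) + b x) \<le> real (card R) * (\<epsilon>\<^sup>2 * pot U \<tau> S)"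
    and "\<And>x. x \<in> R \<Longrightarrow> c x \<le> pot U \<tau> S - pot U \<tau> (insert x S) + b x"
proof -
  define G where "G = dense_elems A c f k \<tau> S"
  have SV: "S \<subseteq> V" and \<tau>: "0 < \<tau>" using assms(1) by (auto simp: admissible_def)
  have RV: "R \<subseteq> V" and finR: "finite R" using assms finite_V finite_subset[of R V] by auto
  have drop: "real (gn S x) / \<tau> \<le> pot U \<tau> S - pot U \<tau> (insert x S)" if "x \<in> V" for x
    using pot_insert[OF assms(1,2) that] by simp
  have G: "c x \<le> real (gn S x) / \<tau>" if "x \<in> G" for x
    using that \<tau> by (simp add: G_def dense_elems_def pos_le_divide_eq mult.commute)
  have GR: "G \<subseteq> R"
  proof
    fix x assume x: "x \<in> G"
    hence "x \<in> A" "0 < c x" using assms(3) c_pos by (auto simp: G_def dense_elems_def)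
    moreover have "x \<notin> S" using G[OF x] \<open>0 < c x\<close> by (auto simp: gain_mem)
    ultimately show "x \<in> R" using assms(4) by simp
  qed
  show "c x \<le> pot U \<tau> S - pot U \<tau> (insert x S) + b x" if "x \<in> R" for x
  proof (cases "x \<in> G")
    case True
    thus ?thesis using drop[of x] G[of x] RV that by (auto simp: b_def G_def)
  next
    case False
    have "0 \<le> real (gn S x) / \<tau>" using \<tau> by simp
    thus ?thesis using drop[of x] RV that False by (auto simp: b_def G_def)
  qed
  have "(\<Sum>x\<in>R. b x) = cost c (R - G)"
  proof -
    have "(\<Sum>x\<in>R. b x) = (\<Sum>x\<in>R - G. b x)"
      using finR by (intro sum.mono_neutral_right) (auto simp: b_def G_def)
    also have "\<dots> = cost c (R - G)"
      unfolding cost_def by (rule sum.cong) (auto simp: b_def G_def)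
    finally show ?thesis .
  qed
  also have "\<dots> = cost c R - cost c G"
    unfolding cost_def using finR GR by (rule sum_diff)
  \<comment> \<open>The test gives \<open>cost c R \<le> cost c A \<le> (1 + \<epsilon>\<^sup>2) *
    cost c G\<close>. Under uniform sampling the mean of \<open>b\<close> is this total divided by
    \<open>card R\<close>, which is why the test weighs elements by cost.\<close>
  also have "\<dots> \<le> \<epsilon>\<^sup>2 * cost c G"
    using assms(6) cost_mono[of R A] assms(3,4) by (auto simp: G_def algebra_simps)
  also have "\<dots> \<le> \<epsilon>\<^sup>2 * (\<Sum>x\<in>R. pot U \<tau> S - pot U \<tau> (insert x S))"
  proof (rule mult_left_mono)
    have "cost c G \<le> (\<Sum>x\<in>G. real (gn S x) / \<tau>)"
      unfolding cost_def by (rule sum_mono) (rule G)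
    also have "\<dots> \<le> (\<Sum>x\<in>R. real (gn S x) / \<tau>)"
      using finR GR \<tau> by (intro sum_mono2) auto
    also have "\<dots> \<le> (\<Sum>x\<in>R. pot U \<tau> S - pot U \<tau> (insert x S))"
      using RV by (intro sum_mono drop) auto
    finally show "cost c G \<le> (\<Sum>x\<in>R. pot U \<tau> S - pot U \<tau> (insert x S))" .
  qed simp
  finally show "(\<Sum>x\<in>R. \<epsilon>\<^sup>2 * pot U \<tau> (insert x S) + b x) \<le> real (card R) * (\<epsilon>\<^sup>2 * pot U \<tau> S)"
    by (simp add: sum.distrib sum_subtractf algebra_simps flip: sum_distrib_left)
qed

text \<open>
  \<open>ennreal\<close> truncates negative numbers to 0, so the integrand is the positive part of the
  cost in excess of the potential.
\<close>
lemma expected_excess_phase: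
  fixes K :: "'a set \<Rightarrow> 'a set pmf"
  assumes "U \<subseteq> V" "A \<subseteq> V"
    and K: "\<And>S. admissible \<tau> S \<Longrightarrow> P (S :: 'a set) \<Longrightarrow>
      (\<integral>\<^sup>+B. ennreal (cost c B - cost c S - pot U \<tau> S) \<partial>K S) \<le> ennreal (\<epsilon>\<^sup>2 * pot U \<tau> S)"
    and "admissible \<tau> S" "R = A - S"
    and "\<And>xs. xs \<in> permutations_of_set R \<Longrightarrow> P (add_prefix f c k (\<epsilon>\<^sup>2) \<tau> A S xs)"
  shows "(\<integral>\<^sup>+xs. \<integral>\<^sup>+B. ennreal (cost c B - cost c S - pot U \<tau> S)
      \<partial>K (add_prefix f c k (\<epsilon>\<^sup>2) \<tau> A S xs) \<partial>pmf_of_set (permutations_of_set R))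
    \<le> ennreal (\<epsilon>\<^sup>2 * pot U \<tau> S)"
  using assms(4-6)
\<comment> \<open>Induction on the number of elements not yet drawn, with \<open>A\<close> fixed.
  \<open>P\<close> is known only where the prefix ends, so \<open>K\<close> is applied only
  there.\<close>
proof (induction "card R" arbitrary: R S rule: less_induct)
  case less
  have RV: "R \<subseteq> V" and finR: "finite R"
    using less.prems assms(2) finite_V finite_subset[of R V] by auto
  show ?case
  proof (cases "R \<noteq> {} \<and> cost c A \<le> (1 + \<epsilon>\<^sup>2) * cost c (dense_elems A c f k \<tau> S)")
    case False
    have stay: "add_prefix f c k (\<epsilon>\<^sup>2) \<tau> A S xs = S" if "xs \<in> permutations_of_set R" for xs
      using False that by (cases xs) (auto dest: permutations_of_setD)
    obtain xs where "xs \<in> permutations_of_set R"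
      using permutations_of_set_empty_iff[of R] finR by blast
    hence "P S" using less.prems(3) stay by metis
    have "(\<integral>\<^sup>+xs. \<integral>\<^sup>+B. ennreal (cost c B - cost c S - pot U \<tau> S)
        \<partial>K (add_prefix f c k (\<epsilon>\<^sup>2) \<tau> A S xs) \<partial>pmf_of_set (permutations_of_set R))
      = (\<integral>\<^sup>+xs. \<integral>\<^sup>+B. ennreal (cost c B - cost c S - pot U \<tau> S) \<partial>K S \<partial>pmf_of_set (permutations_of_set R))"
      using stay finR by (intro nn_integral_cong_AE AE_pmfI) (simp add: set_pmf_of_set)
    also have "\<dots> = (\<integral>\<^sup>+B. ennreal (cost c B - cost c S - pot U \<tau> S) \<partial>K S)"
      by simp
    finally show ?thesis using K[OF less.prems(1) \<open>P S\<close>] by simp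
  next
    case True
    define b where "b = (\<lambda>x. if x \<in> dense_elems A c f k \<tau> S then 0 else c x)"
    note step = uniform_step[OF less.prems(1) assms(1,2) less.prems(2) conjunct1[OF True] conjunct2[OF True]]
    have step1: "(\<Sum>x\<in>R. \<epsilon>\<^sup>2 * pot U \<tau> (insert x S) + b x) \<le> real (card R) * (\<epsilon>\<^sup>2 * pot U \<tau> S)"
      unfolding b_def by (rule step(1))
    have SV: "S \<subseteq> V" using less.prems(1) by (simp add: admissible_def)
    have b0: "0 \<le> b x" if "x \<in> R" for x
      using that RV c_pos by (auto simp: b_def subset_iff intro: less_imp_le)
    have pot0: "0 \<le> pot U \<tau> (insert x S)" if "x \<in> R" for x
      by (rule pot_nonneg[OF admissible_mono[OF less.prems(1)] assms(1)]) (use that RV SV in auto)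
    let ?E = "\<lambda>S' x xs. \<integral>\<^sup>+B. ennreal (cost c B - cost c S' - pot U \<tau> S')
        \<partial>K (add_prefix f c k (\<epsilon>\<^sup>2) \<tau> A (insert x S) xs)"
    \<comment> \<open>With first element \<open>x\<close>, the excess relative to \<open>S\<close>
      is at most the excess relative to \<open>insert x S\<close> plus \<open>b x\<close>; the
      induction hypothesis bounds the former.\<close>
    have inner: "(\<integral>\<^sup>+xs. ?E S x xs \<partial>pmf_of_set (permutations_of_set (R - {x})))
      \<le> ennreal (\<epsilon>\<^sup>2 * pot U \<tau> (insert x S) + b x)" if x: "x \<in> R" for x
    proof -
      have "x \<notin> S" "finite S" using x less.prems(2) SV finite_V finite_subset by auto
      hence cost_ins: "cost c (insert x S) = cost c S + c x" by (simp add: cost_def)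
      have "(\<integral>\<^sup>+xs. ?E S x xs \<partial>pmf_of_set (permutations_of_set (R - {x})))
        \<le> (\<integral>\<^sup>+xs. \<integral>\<^sup>+B. ennreal (cost c B - cost c (insert x S) - pot U \<tau> (insert x S)) + ennreal (b x)
            \<partial>K (add_prefix f c k (\<epsilon>\<^sup>2) \<tau> A (insert x S) xs) \<partial>pmf_of_set (permutations_of_set (R - {x})))"
      proof (intro nn_integral_mono)
        fix xs B
        have "cost c B - cost c S - pot U \<tau> S
          \<le> max 0 (cost c B - cost c (insert x S) - pot U \<tau> (insert x S)) + b x"
          using step(2)[OF x] cost_ins unfolding b_def by linarith
        hence "ennreal (cost c B - cost c S - pot U \<tau> S)
          \<le> ennreal (max 0 (cost c B - cost c (insert x S) - pot U \<tau> (insert x S)) + b x)"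
          by (rule ennreal_leI)
        also have "\<dots> = ennreal (cost c B - cost c (insert x S) - pot U \<tau> (insert x S)) + ennreal (b x)"
          using b0[OF x] by (simp add: ennreal_plus max_def ennreal_neg)
        finally show "ennreal (cost c B - cost c S - pot U \<tau> S)
          \<le> ennreal (cost c B - cost c (insert x S) - pot U \<tau> (insert x S)) + ennreal (b x)" .
      qed
      also have "\<dots> = (\<integral>\<^sup>+xs. ?E (insert x S) x xs \<partial>pmf_of_set (permutations_of_set (R - {x}))) + ennreal (b x)"
        by (simp add: nn_integral_add)
      also have "(\<integral>\<^sup>+xs. ?E (insert x S) x xs \<partial>pmf_of_set (permutations_of_set (R - {x})))
        \<le> ennreal (\<epsilon>\<^sup>2 * pot U \<tau> (insert x S))"
      proof (rule less.hyps)
        show "card (R - {x}) < card R" using finR x by (rule card_Diff1_less)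
        show "admissible \<tau> (insert x S)"
          by (rule admissible_mono[OF less.prems(1)]) (use x RV SV in auto)
        show "R - {x} = A - insert x S" using less.prems(2) by auto
        fix xs assume "xs \<in> permutations_of_set (R - {x})"
        hence "x # xs \<in> permutations_of_set R"
          using x by (auto simp: permutations_of_set_def)
        from less.prems(3)[OF this]
        show "P (add_prefix f c k (\<epsilon>\<^sup>2) \<tau> A (insert x S) xs)" using True by simp
      qed
      also have "ennreal (\<epsilon>\<^sup>2 * pot U \<tau> (insert x S)) + ennreal (b x)
        = ennreal (\<epsilon>\<^sup>2 * pot U \<tau> (insert x S) + b x)"
        using b0[OF x] pot0[OF x] by (simp add: ennreal_plus)
      finally show ?thesis by (simp add: add_right_mono)
    qed
    have cR: "0 < card R" using True finR by (simp add: card_gt_0_iff)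
    \<comment> \<open>A uniform permutation is a uniform first element followed by a uniform
      permutation of the rest; averaging \<open>inner\<close> over \<open>x\<close> then reduces the
      claim to \<open>uniform_step\<close>.\<close>
    have "(\<integral>\<^sup>+xs. \<integral>\<^sup>+B. ennreal (cost c B - cost c S - pot U \<tau> S)
        \<partial>K (add_prefix f c k (\<epsilon>\<^sup>2) \<tau> A S xs) \<partial>pmf_of_set (permutations_of_set R))
      = (\<integral>\<^sup>+x. \<integral>\<^sup>+xs. ?E S x xs \<partial>pmf_of_set (permutations_of_set (R - {x})) \<partial>pmf_of_set R)"
      using True finR by (subst random_permutation_of_set) auto
    also have "\<dots> \<le> (\<integral>\<^sup>+x. ennreal (\<epsilon>\<^sup>2 * pot U \<tau> (insert x S) + b x) \<partial>pmf_of_set R)"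
      using inner True finR by (intro nn_integral_mono_AE AE_pmfI) (simp add: set_pmf_of_set)
    also have "\<dots> = (\<Sum>x\<in>R. ennreal (\<epsilon>\<^sup>2 * pot U \<tau> (insert x S) + b x)) / ennreal (real (card R))"
      using True finR by (simp add: nn_integral_pmf_of_set ennreal_of_nat_eq_real_of_nat)
    also have "\<dots> = ennreal ((\<Sum>x\<in>R. \<epsilon>\<^sup>2 * pot U \<tau> (insert x S) + b x) / real (card R))"
      using b0 pot0 cR by (subst sum_ennreal) (auto intro!: divide_ennreal sum_nonneg add_nonneg_nonneg)
    also have "\<dots> \<le> ennreal (\<epsilon>\<^sup>2 * pot U \<tau> S)"
      using step1 cR by (intro ennreal_leI) (simp add: pos_divide_le_eq mult.commute)
    finally show ?thesis .
  qed
qed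

text \<open>The error \<open>\<epsilon>\<^sup>2 * pot U \<tau> S\<close> does not accumulate over
  phases, since what a step adds to it is paid for by the drop of the potential. Lowering the
  threshold is harmless by \<open>pot_lower\<close>.\<close>

lemma expected_excess:
  assumes "U \<subseteq> V" "k \<le> f U" "ready n t \<tau> S"
    and "real (card V) * real k < (1 - \<epsilon>) * (1 + \<epsilon>\<^sup>2) ^ t0"
  shows "(\<integral>\<^sup>+B. ennreal (cost c B - cost c S - pot U \<tau> S)
      \<partial>map_pmf snd (run f (threshold_alg V c k \<epsilon> t0 n t \<tau> S))) \<le> ennreal (\<epsilon>\<^sup>2 * pot U \<tau> S)"
  using assms(3)
proof (induction n t arbitrary: \<tau> S rule: threshold_induct[where ?t0.0 = t0])
  case stop
  thus ?case using pot_nonneg[OF readyD(1) assms(1)] by (simp add: ennreal_neg)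
next
  case (lower n)
  have le: "pot U ((1 - \<epsilon>) * \<tau>) S \<le> pot U \<tau> S"
    using readyD(2,3)[OF lower.prems] assms(1,2) eps_pos eps_less
    by (intro pot_lower) (auto simp: mult_le_cancel_right1)
  have "(\<integral>\<^sup>+B. ennreal (cost c B - cost c S - pot U \<tau> S)
      \<partial>map_pmf snd (run f (threshold_alg V c k \<epsilon> t0 n t0 ((1 - \<epsilon>) * \<tau>) S)))
    \<le> (\<integral>\<^sup>+B. ennreal (cost c B - cost c S - pot U ((1 - \<epsilon>) * \<tau>) S)
      \<partial>map_pmf snd (run f (threshold_alg V c k \<epsilon> t0 n t0 ((1 - \<epsilon>) * \<tau>) S)))"
    using le by (intro nn_integral_mono ennreal_leI) simp
  also have "\<dots> \<le> ennreal (\<epsilon>\<^sup>2 * pot U ((1 - \<epsilon>) * \<tau>) S)"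
    by (rule lower.IH[OF ready_lower[OF lower.prems assms(4)]])
  also have "\<dots> \<le> ennreal (\<epsilon>\<^sup>2 * pot U \<tau> S)"
    using le by (intro ennreal_leI mult_left_mono) auto
  finally show ?case by simp
next
  case (phase n t)
  define A where "A = dense \<tau> S"
  have AV: "A \<subseteq> V" by (simp add: A_def dense_elems_subset)
  \<comment> \<open>Elements of \<open>S\<close> have gain 0 but positive cost, so they are never
    dense.\<close>
  have AS: "A = A - S"
  proof -
    have "v \<notin> S" if "v \<in> A" for v
      using that readyD(3)[OF phase.prems] c_pos[of v] by (auto simp: A_def dense_elems_def gain_mem mult_le_0_iff)
    thus ?thesis by auto
  qed
  let ?K = "\<lambda>S'. map_pmf snd (run f (threshold_alg V c k \<epsilon> t0 n t \<tau> S'))"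
  have "map_pmf snd (run f (threshold_alg V c k \<epsilon> t0 n (Suc t) \<tau> S)) =
    bind_pmf (pmf_of_set (permutations_of_set A)) (\<lambda>xs. ?K (add_prefix f c k (\<epsilon>\<^sup>2) \<tau> A S xs))"
    unfolding run_threshold_alg_Suc[OF finite_V] A_def[symmetric]
    by (simp add: map_bind_pmf map_pmf_comp split_def)
  moreover have "(\<integral>\<^sup>+xs. \<integral>\<^sup>+B. ennreal (cost c B - cost c S - pot U \<tau> S)
      \<partial>?K (add_prefix f c k (\<epsilon>\<^sup>2) \<tau> A S xs) \<partial>pmf_of_set (permutations_of_set A))
    \<le> ennreal (\<epsilon>\<^sup>2 * pot U \<tau> S)"
  proof (rule expected_excess_phase[where P = "ready n t \<tau>"])
    show "ready n t \<tau> (add_prefix f c k (\<epsilon>\<^sup>2) \<tau> A S xs)" if "xs \<in> permutations_of_set A" for xs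
      using ready_phase[OF phase.prems, of xs] permutations_of_setD(1)[OF that] by (simp add: A_def)
  qed (use assms(1) AV AS readyD(1,3)[OF phase.prems] phase.IH in \<open>assumption | blast\<close>)+
  ultimately show ?case by (simp only: nn_integral_bind_pmf)
qed

section \<open>Success probability\<close>

text \<open>The allowed cost exceeds \<open>G\<close>, and hence the potential \<open>a\<close>, by
  at least \<open>3 * \<epsilon> * G\<close>, while the mean excess is at most
  \<open>\<epsilon>\<^sup>2 * a\<close>. Markov's inequality bounds the failure probability well
  below \<open>3 * \<epsilon>\<close>; feasibility is certain.\<close>

lemma threshold_alg_success:
  assumes "U \<subseteq> V" "k \<le> f U" "ready n t \<tau> {}"
    and "real (card V) * real k < (1 - \<epsilon>) * (1 + \<epsilon>\<^sup>2) ^ t0"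
  defines "H \<equiv> harm (min (Max ((\<lambda>v. f {v}) ` V)) k)"
  shows "1 - 3 * \<epsilon> \<le> output_prob f (threshold_alg V c k \<epsilon> t0 n t \<tau> {})
    (\<lambda>B. B \<subseteq> V \<and> k \<le> f B \<and> cost c B \<le> H / (1 - 4 * \<epsilon>) * cost c U)"
proof -
  define M where "M = run f (threshold_alg V c k \<epsilon> t0 n t \<tau> {})"
  define a where "a = pot U \<tau> {}"
  define G where "G = H / (1 - \<epsilon>) * cost c U"
  define bad where "bad = {B. H / (1 - 4 * \<epsilon>) * cost c U < cost c B}"
  have a0: "0 \<le> a" unfolding a_def by (rule pot_nonneg[OF readyD(1)[OF assms(3)] assms(1)])
  have aG: "a \<le> G"
    unfolding a_def G_def H_def by (rule pot_le_harm[OF assms(1,2) readyD(3)[OF assms(3)]])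
  have bound: "G + 3 * \<epsilon> * G \<le> H / (1 - 4 * \<epsilon>) * cost c U"
  proof -
    have "(1 + 3 * \<epsilon>) * (1 - 4 * \<epsilon>) \<le> 1 - \<epsilon>"
      using eps_pos by (simp add: algebra_simps)
    hence "(1 + 3 * \<epsilon>) / (1 - \<epsilon>) \<le> 1 / (1 - 4 * \<epsilon>)"
      using eps_pos eps_less by (simp add: divide_simps)
    moreover have "0 \<le> H * cost c U"
      unfolding H_def using cost_nonneg[OF assms(1)] by (simp add: harm_nonneg)
    ultimately have "(1 + 3 * \<epsilon>) / (1 - \<epsilon>) * (H * cost c U) \<le> 1 / (1 - 4 * \<epsilon>) * (H * cost c U)"
      by (rule mult_right_mono)
    thus ?thesis by (simp add: G_def add_divide_distrib algebra_simps)
  qed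
  have excess: "(\<integral>\<^sup>+B. ennreal (cost c B - a) \<partial>map_pmf snd M) \<le> ennreal (\<epsilon>\<^sup>2 * a)"
    using expected_excess[OF assms(1-4)] by (simp add: a_def M_def cost_def)
  have "measure_pmf.prob (map_pmf snd M) bad \<le> 3 * \<epsilon>"
  \<comment> \<open>Markov's inequality divides by \<open>3 * \<epsilon> * G\<close>. For
    \<open>G = 0\<close> the mean excess is 0, so almost surely there is none.\<close>
  proof (cases "G = 0")
    case True
    hence "a = 0" using a0 aG by simp
    hence "(\<integral>\<^sup>+B. ennreal (cost c B - a) \<partial>map_pmf snd M) = 0" using excess by simp
    hence "AE B in map_pmf snd M. ennreal (cost c B - a) = 0"
      by (subst (asm) nn_integral_0_iff_AE) auto
    hence "AE B in map_pmf snd M. B \<notin> bad"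
      using bound True \<open>a = 0\<close> by (elim eventually_mono) (auto simp: bad_def ennreal_eq_0_iff)
    hence "measure_pmf.prob (map_pmf snd M) bad = 0"
      by (subst measure_pmf.prob_eq_0) auto
    thus ?thesis using eps_pos by simp
  next
    case False
    hence G: "0 < G" using a0 aG by simp
    define x where "x = 3 * \<epsilon> * G"
    have x: "0 < x" using G eps_pos by (simp add: x_def)
    have "bad \<subseteq> {B \<in> UNIV. 1 \<le> ennreal (1 / x) * ennreal (cost c B - a)}"
    proof
      fix B assume "B \<in> bad"
      hence "x \<le> cost c B - a" using bound aG by (simp add: bad_def x_def)
      hence "1 \<le> 1 / x * (cost c B - a)" using x by simp
      hence "ennreal 1 \<le> ennreal (1 / x * (cost c B - a))" by (rule ennreal_leI)
      also have "\<dots> = ennreal (1 / x) * ennreal (cost c B - a)"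
        using x by (intro ennreal_mult') auto
      finally show "B \<in> {B \<in> UNIV. 1 \<le> ennreal (1 / x) * ennreal (cost c B - a)}" by simp
    qed
    hence "emeasure (map_pmf snd M) bad
      \<le> emeasure (map_pmf snd M) {B \<in> UNIV. 1 \<le> ennreal (1 / x) * ennreal (cost c B - a)}"
      by (intro emeasure_mono) auto
    also have "\<dots> \<le> ennreal (1 / x) * (\<integral>\<^sup>+B. ennreal (cost c B - a) * indicator UNIV B \<partial>map_pmf snd M)"
      by (rule nn_integral_Markov_inequality) auto
    also have "\<dots> \<le> ennreal (1 / x) * ennreal (\<epsilon>\<^sup>2 * a)"
      using excess by (intro mult_left_mono) auto
    also have "\<dots> = ennreal (1 / x * (\<epsilon>\<^sup>2 * a))"
      using x by (intro ennreal_mult'[symmetric]) auto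
    also have "\<dots> \<le> ennreal (3 * \<epsilon>)"
    proof (rule ennreal_leI)
      have "\<epsilon>\<^sup>2 * a \<le> (3 * \<epsilon>) * x"
      proof -
        \<comment> \<open>The 9 is slack: \<open>3 * \<epsilon> * x\<close> equals
          \<open>9 * \<epsilon>\<^sup>2 * G\<close>.\<close>
        have "\<epsilon>\<^sup>2 * a \<le> \<epsilon>\<^sup>2 * (9 * G)" using aG G by (intro mult_left_mono) auto
        thus ?thesis by (simp add: x_def power2_eq_square)
      qed
      thus "1 / x * (\<epsilon>\<^sup>2 * a) \<le> 3 * \<epsilon>" using x by (simp add: divide_le_eq)
    qed
    finally show ?thesis
      using eps_pos by (simp add: measure_pmf.emeasure_eq_measure)
  qed
  hence "1 - 3 * \<epsilon> \<le> measure_pmf.prob M (- (snd -` bad))"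
    using measure_pmf.prob_compl[of "snd -` bad" M] by (simp add: Compl_eq_Diff_UNIV)
  also have "\<dots> \<le> measure_pmf.prob M {(Qs, B). B \<subseteq> V \<and> k \<le> f B \<and> cost c B \<le> H / (1 - 4 * \<epsilon>) * cost c U}"
  proof (rule measure_pmf.finite_measure_mono_AE, rule AE_pmfI)
    fix z assume "z \<in> set_pmf M"
    thus "z \<in> - (snd -` bad) \<longrightarrow> z \<in> {(Qs, B). B \<subseteq> V \<and> k \<le> f B \<and> cost c B \<le> H / (1 - 4 * \<epsilon>) * cost c U}"
      using threshold_alg_support[OF assms(3,4), of "fst z" "snd z"]
      by (auto simp: M_def bad_def split_def not_less)
  qed simp
  finally show ?thesis by (simp add: output_prob_def M_def)
qed

end

section \<open>Choice of parameters, round count and the case k = 1\<close>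

text \<open>By Bernoulli's inequality the first factor is enough phases to double
  \<open>(1 + \<epsilon>\<^sup>2) ^ t\<close>; the second is the number of doublings that reaches
  \<open>2 * m * k\<close>, where the 2 makes up for \<open>1 - \<epsilon>\<close>.\<close>

definition num_phases :: "nat \<Rightarrow> nat \<Rightarrow> real \<Rightarrow> nat" where
  "num_phases m k \<epsilon> = nat \<lceil>1 / \<epsilon>\<^sup>2\<rceil> * nat \<lceil>log 2 (2 * real m * real k)\<rceil>"

definition cheapest_alg :: "'a set \<Rightarrow> ('a \<Rightarrow> real) \<Rightarrow> 'a oracle_alg" where
  "cheapest_alg V c = Query (batch V {} [])
     (\<lambda>r. Output (if 1 \<le> r {} then {} else {arg_min_on c {v \<in> V. 1 \<le> r {v}}}))"

text \<open>No density exceeds the initial threshold \<open>k / Min (c\<close>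
  V)\<open>, and after the given number of lowerings it is at most\<close>1 / Max (c
  \<open>V)\<close>, as \<open>feasible_if_ready\<close> demands.\<close>

definition minsmc_alg :: "'a set \<Rightarrow> ('a \<Rightarrow> real) \<Rightarrow> nat \<Rightarrow> real \<Rightarrow> 'a oracle_alg" where
  "minsmc_alg V c k \<epsilon> =
     (if k = 1 then cheapest_alg V c
      else threshold_alg V c k \<epsilon> (num_phases (card V) k \<epsilon>) (nat \<lceil>minsmc_T V c k \<epsilon>\<rceil>)
        (num_phases (card V) k \<epsilon>) (real k / Min (c ` V)) {})"

context minsmc
begin

lemma card_V_pos: "1 \<le> card V"
  using finite_V nonempty_V by (simp add: Suc_le_eq card_gt_0_iff)

lemma num_phases_sufficient:
  "real (card V) * real k < (1 - \<epsilon>) * (1 + \<epsilon>\<^sup>2) ^ num_phases (card V) k \<epsilon>"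
proof -
  define q where "q = nat \<lceil>1 / \<epsilon>\<^sup>2\<rceil>"
  define l where "l = nat \<lceil>log 2 (2 * real (card V) * real k)\<rceil>"
  define x where "x = real (card V) * real k"
  have x: "0 < x" using card_V_pos k_pos by (simp add: x_def)
  have "1 / \<epsilon>\<^sup>2 \<le> real q" unfolding q_def by (rule real_nat_ceiling_ge)
  hence "1 \<le> real q * \<epsilon>\<^sup>2" using eps_pos by (simp add: pos_divide_le_eq)
  hence "2 \<le> 1 + real q * \<epsilon>\<^sup>2" by simp
  also have "\<dots> \<le> (1 + \<epsilon>\<^sup>2) ^ q" by (rule Bernoulli_inequality) (use eps_sq(2) in linarith)
  finally have "2 ^ l \<le> ((1 + \<epsilon>\<^sup>2) ^ q) ^ l" by (intro power_mono) auto
  also have "\<dots> = (1 + \<epsilon>\<^sup>2) ^ num_phases (card V) k \<epsilon>"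
    by (simp add: num_phases_def q_def l_def power_mult)
  finally have 1: "2 ^ l \<le> (1 + \<epsilon>\<^sup>2) ^ num_phases (card V) k \<epsilon>" .
  have "log 2 (2 * x) \<le> real l" unfolding l_def x_def mult.assoc by (rule real_nat_ceiling_ge)
  hence "2 * x \<le> 2 ^ l" using x by (simp add: log_le_iff powr_realpow)
  with 1 have 2: "2 * x \<le> (1 + \<epsilon>\<^sup>2) ^ num_phases (card V) k \<epsilon>" by linarith
  have "x < (1 - \<epsilon>) * (2 * x)" using x eps_less by simp
  also have "\<dots> \<le> (1 - \<epsilon>) * (1 + \<epsilon>\<^sup>2) ^ num_phases (card V) k \<epsilon>"
    using 2 eps_less by (intro mult_left_mono) auto
  finally show ?thesis by (simp add: x_def)
qed

lemma Min_Max_cost: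
  shows "0 < Min (c ` V)"
    and "v \<in> V \<Longrightarrow> Min (c ` V) \<le> c v"
    and "v \<in> V \<Longrightarrow> c v \<le> Max (c ` V)"
    and "Min (c ` V) \<le> Max (c ` V)"
proof -
  show "Min (c ` V) \<le> Max (c ` V)"
    using finite_V nonempty_V by (meson Max_ge Min_in finite_imageI image_is_empty)
qed (use finite_V nonempty_V c_pos in auto)

lemma cost_ratio_le:
  defines "T \<equiv> minsmc_T V c k \<epsilon>"
  shows "real k * Max (c ` V) / Min (c ` V) \<le> (1 / (1 - \<epsilon>)) ^ nat \<lceil>T\<rceil>"
proof -
  have b: "1 < 1 / (1 - \<epsilon>)" using eps_pos eps_less by (simp add: less_divide_eq)
  have pos: "0 < real k * Max (c ` V) / Min (c ` V)"
    using Min_Max_cost k_pos by (intro divide_pos_pos mult_pos_pos) auto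
  have "T \<le> real (nat \<lceil>T\<rceil>)" by (rule real_nat_ceiling_ge)
  hence "real k * Max (c ` V) / Min (c ` V) \<le> (1 / (1 - \<epsilon>)) powr real (nat \<lceil>T\<rceil>)"
    unfolding T_def minsmc_T_def using log_le_iff[OF b pos] by blast
  also have "\<dots> = (1 / (1 - \<epsilon>)) ^ nat \<lceil>T\<rceil>" using b by (intro powr_realpow) linarith
  finally show ?thesis .
qed

lemma ready_initial:
  "ready (nat \<lceil>minsmc_T V c k \<epsilon>\<rceil>) (num_phases (card V) k \<epsilon>) (real k / Min (c ` V)) {}"
proof (rule ready_start[OF _ _ num_phases_sufficient])
  show "admissible (real k / Min (c ` V)) {}"
    unfolding admissible_def
  proof (intro conjI ballI)
    show "0 < real k / Min (c ` V)" using Min_Max_cost(1) k_pos by simp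
    fix v assume "v \<in> V"
    have "(1 - \<epsilon>) * real (gn {} v) \<le> 1 * real k"
      using eps_pos eps_less gain_le[of "{}" v] by (intro mult_mono) auto
    also have "\<dots> \<le> real k / Min (c ` V) * c v"
      using Min_Max_cost(1) Min_Max_cost(2)[OF \<open>v \<in> V\<close>]
      by (simp add: pos_le_divide_eq mult_left_mono)
    finally show "(1 - \<epsilon>) * real (gn {} v) \<le> real k / Min (c ` V) * c v" .
  qed simp
  show "\<forall>v\<in>V. (1 - \<epsilon>) ^ nat \<lceil>minsmc_T V c k \<epsilon>\<rceil> * (real k / Min (c ` V)) * c v \<le> 1"
  proof
    fix v assume "v \<in> V"
    define n where "n = nat \<lceil>minsmc_T V c k \<epsilon>\<rceil>"
    have p: "0 < (1 - \<epsilon>) ^ n" using eps_less by simp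
    have "real k / Min (c ` V) * c v \<le> real k / Min (c ` V) * Max (c ` V)"
      using Min_Max_cost(1) Min_Max_cost(3)[OF \<open>v \<in> V\<close>] by (intro mult_left_mono) auto
    also have "\<dots> \<le> 1 / (1 - \<epsilon>) ^ n"
      using cost_ratio_le by (simp add: n_def power_one_over)
    finally show "(1 - \<epsilon>) ^ n * (real k / Min (c ` V)) * c v \<le> 1"
      using p by (simp add: pos_le_divide_eq mult_ac)
  qed
qed

text \<open>The constant is 2 rounds per phase times 2, 3 and 2 from rounding up
  \<open>1 / \<epsilon>\<^sup>2\<close>, the logarithm and \<open>T\<close>. For
  \<open>k \<ge> 2\<close> the bounds \<open>T \<ge> 2\<close>, \<open>K \<ge> 1\<close> and
  \<open>L \<ge> M + 1\<close> absorb all additive terms.\<close>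

lemma num_rounds_le:
  assumes "k \<noteq> 1"
  defines "T \<equiv> minsmc_T V c k \<epsilon>" and "t0 \<equiv> num_phases (card V) k \<epsilon>"
  shows "real (2 * (t0 + nat \<lceil>T\<rceil> * t0)) \<le> 24 * round_bound T k (card V) \<epsilon>"
proof -
  define K where "K = log 2 (real k)"
  define M where "M = log 2 (real (card V))"
  define L where "L = M + log 2 (T * K)"
  have k: "2 \<le> k" using assms(1) k_pos by simp
  have K: "1 \<le> K" using k by (simp add: K_def le_log_iff)
  have M: "0 \<le> M" using card_V_pos by (simp add: M_def)
  \<comment> \<open>Two lowerings cannot even halve the threshold, as
    \<open>(3 / 4)\<^sup>2 > 1 / 2\<close>, whereas the argument of the logarithm is at least
    \<open>k \<ge> 2\<close>.\<close>
  have T: "2 \<le> T"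
  proof -
    have b: "1 < 1 / (1 - \<epsilon>)" using eps_pos eps_less by (simp add: less_divide_eq)
    have "(3 / 4) ^ 2 \<le> (1 - \<epsilon>) ^ 2" using eps_less by (intro power_mono) auto
    hence "1 / 2 \<le> (1 - \<epsilon>)\<^sup>2" by (simp add: power2_eq_square)
    hence "(1 / (1 - \<epsilon>)) powr 2 \<le> 2"
      using b eps_less by (simp add: power_one_over divide_simps mult.commute)
    also have "2 \<le> real k * 1" using k by simp
    also have "\<dots> \<le> real k * (Max (c ` V) / Min (c ` V))"
      using Min_Max_cost by (intro mult_left_mono) auto
    finally have *: "(1 / (1 - \<epsilon>)) powr 2 \<le> real k * Max (c ` V) / Min (c ` V)" by simp
    have "0 < (1 / (1 - \<epsilon>)) powr 2" using b eps_less by simp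
    hence "0 < real k * Max (c ` V) / Min (c ` V)" using * by linarith
    thus ?thesis unfolding T_def minsmc_T_def using b * by (subst le_log_iff) auto
  qed
  have "2 * 1 \<le> T * K" using T K by (intro mult_mono) auto
  hence L: "M + 1 \<le> L" by (simp add: L_def le_log_iff)
  have N: "1 + real (nat \<lceil>T\<rceil>) \<le> 2 * T" using T by linarith
  have q: "real (nat \<lceil>1 / \<epsilon>\<^sup>2\<rceil>) \<le> 2 / \<epsilon>\<^sup>2"
  proof -
    have "\<epsilon>\<^sup>2 \<le> 1" using eps_pos eps_less by (simp add: power_le_one)
    hence "1 \<le> 1 / \<epsilon>\<^sup>2" using eps_pos by (simp add: pos_le_divide_eq)
    thus ?thesis by linarith
  qed
  have l: "real (nat \<lceil>log 2 (2 * real (card V) * real k)\<rceil>) \<le> 3 * (K * L)"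
  proof -
    have "log 2 (2 * real (card V) * real k) = 1 + M + K"
      using card_V_pos k by (simp add: log_mult K_def M_def)
    moreover have "M * 1 \<le> M * K" using M K by (intro mult_left_mono) auto
    moreover have "K * (M + 1) \<le> K * L" using L K by (intro mult_left_mono) auto
    ultimately show ?thesis using K M by (simp add: algebra_simps) linarith
  qed
  have KL: "0 \<le> K * L" using K L M by simp
  have "real t0 \<le> 2 / \<epsilon>\<^sup>2 * (3 * (K * L))"
    unfolding t0_def num_phases_def of_nat_mult using q l by (intro mult_mono) auto
  hence "real t0 * (1 + real (nat \<lceil>T\<rceil>)) \<le> 2 / \<epsilon>\<^sup>2 * (3 * (K * L)) * (2 * T)"
    using N KL T by (intro mult_mono) auto
  moreover have "real (2 * (t0 + nat \<lceil>T\<rceil> * t0)) = 2 * (real t0 * (1 + real (nat \<lceil>T\<rceil>)))"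
    by (simp add: algebra_simps)
  moreover have "2 * (2 / \<epsilon>\<^sup>2 * (3 * (K * L)) * (2 * T)) = 24 * (T * (K * L)) / \<epsilon>\<^sup>2"
    by simp
  ultimately have "real (2 * (t0 + nat \<lceil>T\<rceil> * t0)) \<le> 24 * (T * (K * L)) / \<epsilon>\<^sup>2"
    by linarith
  \<comment> \<open>The count is of order \<open>1 / \<epsilon>\<^sup>2\<close>, stronger than the
    claimed cubic dependence.\<close>
  also have "\<dots> \<le> 24 * (T * (K * L)) / \<epsilon> ^ 3"
    using T KL eps_pos eps_less by (intro divide_left_mono power_decreasing mult_pos_pos) auto
  also have "\<dots> = 24 * round_bound T k (card V) \<epsilon>"
    by (simp add: round_bound_def L_def K_def M_def mult.assoc)
  finally show ?thesis .
qed

lemma opt_attained: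
  obtains U where "U \<subseteq> V" "k \<le> f U" "cost c U = minsmc_opt V f c k"
proof -
  have "finite {A. A \<subseteq> V \<and> k \<le> f A}" using finite_V by simp
  moreover have "V \<in> {A. A \<subseteq> V \<and> k \<le> f A}" using k_le by simp
  ultimately have "minsmc_opt V f c k \<in> cost c ` {A. A \<subseteq> V \<and> k \<le> f A}"
    unfolding minsmc_opt_def by (intro Min_in) auto
  thus thesis using that by fastforce
qed

text \<open>If the empty set has value 0, \<open>residual_le_cover\<close> yields an element of
  \<open>U\<close> with positive gain. It alone is feasible and costs at most
  \<open>cost c U\<close>, and the approximation factor is at least 1 because
  \<open>harm 1 = 1\<close>.\<close>

lemma cheapest_alg_correct:
  assumes "k = 1" "U \<subseteq> V" "k \<le> f U"
  obtains B where "run f (cheapest_alg V c) = return_pmf ([batch V {} []], B)"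
    and "B \<subseteq> V" "k \<le> f B"
    and "cost c B \<le> harm (min (Max ((\<lambda>v. f {v}) ` V)) k) / (1 - 4 * \<epsilon>) * cost c U"
proof -
  define W where "W = {v \<in> V. 1 \<le> f {v}}"
  define B where "B = (if 1 \<le> f {} then {} else {arg_min_on c W})"
  define H where "H = (harm (min (Max ((\<lambda>v. f {v}) ` V)) k) :: real)"
  have "restrict f (batch V {} []) {} = f {}"
    using batch_memI(1)[of 0 "[]" "{}" V] by simp
  moreover have "{v \<in> V. 1 \<le> restrict f (batch V {} []) {v}} = W"
    using batch_memI(2)[of 0 "[]" _ V "{}"] by (auto simp: W_def)
  ultimately have "run f (cheapest_alg V c) = return_pmf ([batch V {} []], B)"
    by (simp add: cheapest_alg_def B_def)
  moreover have "B \<subseteq> V \<and> k \<le> f B \<and> cost c B \<le> H / (1 - 4 * \<epsilon>) * cost c U"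
  proof (cases "1 \<le> f {}")
    case True
    thus ?thesis
      using assms(1) cost_nonneg[OF assms(2)] eps_less by (simp add: B_def H_def cost_def harm_nonneg)
  next
    case False
    have "\<exists>u\<in>U. gn {} u \<noteq> 0"
    proof (rule ccontr)
      assume "\<not> (\<exists>u\<in>U. gn {} u \<noteq> 0)"
      thus False using residual_le_cover[OF _ assms(2,3), of "{}"] False assms(1) by simp
    qed
    then obtain u where u: "u \<in> U" "gn {} u \<noteq> 0" by blast
    have "u \<in> W" using u assms(1,2) by (auto simp: W_def gain_def Suc_le_eq intro!: Nat.gr0I)
    hence W: "finite W" "W \<noteq> {}" using finite_V by (auto simp: W_def)
    have min: "arg_min_on c W \<in> W" "c (arg_min_on c W) \<le> c u"
      using arg_min_if_finite[OF W, of c] \<open>u \<in> W\<close> by (auto simp: not_less)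
    have "cost c B = c (arg_min_on c W)" using False by (simp add: B_def cost_def)
    also have "\<dots> \<le> cost c {u}" using min by (simp add: cost_def)
    also have "\<dots> \<le> cost c U" using u assms(2) by (intro cost_mono) auto
    also have "\<dots> \<le> H / (1 - 4 * \<epsilon>) * cost c U"
    proof -
      have "f {u} \<le> Max ((\<lambda>v. f {v}) ` V)" using finite_V u assms(2) by (intro Max_ge) auto
      hence "min (Max ((\<lambda>v. f {v}) ` V)) k = 1" using assms(1) \<open>u \<in> W\<close> by (simp add: W_def)
      hence "1 \<le> H / (1 - 4 * \<epsilon>)" using eps_pos eps_less by (simp add: H_def harm_def)
      thus ?thesis using cost_nonneg[OF assms(2)] mult_right_mono by fastforce
    qed
    finally show ?thesis using min False assms(1) by (auto simp: B_def W_def)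
  qed
  ultimately show thesis using that unfolding H_def by blast
qed

text \<open>The comparison cover \<open>U\<close> is an optimal one. The maximum with 1 accommodates
  the single round spent for \<open>k = 1\<close>.\<close>

theorem minsmc_alg_correct:
  defines "T \<equiv> minsmc_T V c k \<epsilon>"
  shows "1 - 3 * \<epsilon> \<le> output_prob f (minsmc_alg V c k \<epsilon>)
      (\<lambda>B. B \<subseteq> V \<and> k \<le> f B \<and>
        cost c B \<le> harm (min (Max ((\<lambda>v. f {v}) ` V)) k) / (1 - 4 * \<epsilon>) * minsmc_opt V f c k)" (is ?thesis1)
    and "takes_rounds V f (minsmc_alg V c k \<epsilon>) (24 * max 1 (round_bound T k (card V) \<epsilon>))
      ((card V + 1) * (card V + 1))" (is ?thesis2)
proof -
  obtain U where U: "U \<subseteq> V" "k \<le> f U" "cost c U = minsmc_opt V f c k"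
    by (rule opt_attained)
  have "?thesis1 \<and> ?thesis2"
  proof (cases "k = 1")
    case True
    then obtain B where B: "run f (cheapest_alg V c) = return_pmf ([batch V {} []], B)"
      "B \<subseteq> V" "k \<le> f B"
      "cost c B \<le> harm (min (Max ((\<lambda>v. f {v}) ` V)) k) / (1 - 4 * \<epsilon>) * cost c U"
      using cheapest_alg_correct[OF _ U(1,2)] by blast
    moreover have "batch V {} [] \<subseteq> Pow V" by (rule batch_subset_Pow) auto
    moreover have "card (batch V {} []) \<le> (card V + 1) * (card V + 1)"
      using finite_V by (intro card_batch_le) auto
    ultimately show ?thesis
      using True eps_pos U(3) by (simp add: minsmc_alg_def output_prob_def takes_rounds_def)
  next
    case False
    define A where "A = minsmc_alg V c k \<epsilon>"
    define t0 where "t0 = num_phases (card V) k \<epsilon>"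
    define n where "n = nat \<lceil>T\<rceil>"
    have A: "A = threshold_alg V c k \<epsilon> t0 n t0 (real k / Min (c ` V)) {}"
      using False by (simp add: A_def minsmc_alg_def t0_def n_def T_def)
    note ready = ready_initial[folded T_def, folded n_def t0_def]
    note suff = num_phases_sufficient[folded t0_def]
    have "?thesis1"
      using threshold_alg_success[OF U(1,2) ready suff] U(3) A by (simp add: A_def)
    moreover have "takes_rounds V f A (24 * max 1 (round_bound T k (card V) \<epsilon>))
      ((card V + 1) * (card V + 1))"
      unfolding takes_rounds_def
    proof (clarify)
      fix Qs B assume "(Qs, B) \<in> set_pmf (run f A)"
      note supp = threshold_alg_support[OF ready suff this[unfolded A]]
      have "real (length Qs) \<le> 24 * round_bound T k (card V) \<epsilon>"
        using supp num_rounds_le[OF False] by (simp add: T_def n_def t0_def)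
      thus "real (length Qs) \<le> 24 * max 1 (round_bound T k (card V) \<epsilon>) \<and>
        (\<forall>Q\<in>set Qs. Q \<subseteq> Pow V \<and> card Q \<le> (card V + 1) * (card V + 1))"
        using supp by auto
    qed
    ultimately show ?thesis by (simp add: A_def)
  qed
  thus ?thesis1 and ?thesis2 by blast+
qed

end

theorem theorem12:
  "\<exists>(C::real) (p::nat poly) (alg :: 'a set \<Rightarrow> ('a \<Rightarrow> real) \<Rightarrow> nat \<Rightarrow> real \<Rightarrow> 'a oracle_alg).
     \<forall>(V::'a set) (c::'a \<Rightarrow> real) (k::nat) (\<epsilon>::real) (f::'a set \<Rightarrow> nat).
       finite V \<longrightarrow> V \<noteq> {} \<longrightarrow>
       mono_on (Pow V) f \<longrightarrow> submodular_on V f \<longrightarrow>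
       (\<forall>v\<in>V. c v > 0) \<longrightarrow>
       1 \<le> k \<longrightarrow> k \<le> f V \<longrightarrow>
       0 < \<epsilon> \<longrightarrow> \<epsilon> < 1 / 4 \<longrightarrow>
       (let m = card V;
            \<Delta> = Max ((\<lambda>v. f {v}) ` V);
            T = minsmc_T V c k \<epsilon>
        in output_prob f (alg V c k \<epsilon>)
             (\<lambda>B. B \<subseteq> V \<and> f B \<ge> k \<and>
                  cost c B \<le> harm (min \<Delta> k) / (1 - 4 * \<epsilon>) * minsmc_opt V f c k)
             \<ge> 1 - 3 * \<epsilon> \<and>
           takes_rounds V f (alg V c k \<epsilon>)
             (C * max 1 (round_bound T k m \<epsilon>)) (poly p m))"
\<comment> \<open>The polynomial is the square of \<open>m + 1\<close>, the batch size bound of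
  \<open>card_batch_le\<close>: at most \<open>m + 1\<close> prefixes with \<open>m + 1\<close>
  extensions each.\<close>
proof (intro exI[of _ "24 :: real"] exI[of _ "[:1, 2, 1:] :: nat poly"] exI[of _ minsmc_alg] allI impI)
  fix V :: "'a set" and c :: "'a \<Rightarrow> real" and k :: nat and \<epsilon> :: real and f :: "'a set \<Rightarrow> nat"
  assume "finite V" "V \<noteq> {}" "mono_on (Pow V) f" "submodular_on V f" "\<forall>v\<in>V. c v > 0"
    "1 \<le> k" "k \<le> f V" "0 < \<epsilon>" "\<epsilon> < 1 / 4"
  then interpret minsmc V c k \<epsilon> f by unfold_locales auto
  have "poly [:1, 2, 1:] (card V) = (card V + 1) * (card V + 1)" by simp
  thus "let m = card V; \<Delta> = Max ((\<lambda>v. f {v}) ` V); T = minsmc_T V c k \<epsilon>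
    in output_prob f (minsmc_alg V c k \<epsilon>)
         (\<lambda>B. B \<subseteq> V \<and> f B \<ge> k \<and>
              cost c B \<le> harm (min \<Delta> k) / (1 - 4 * \<epsilon>) * minsmc_opt V f c k)
         \<ge> 1 - 3 * \<epsilon> \<and>
       takes_rounds V f (minsmc_alg V c k \<epsilon>)
         (24 * max 1 (round_bound T k m \<epsilon>)) (poly [:1, 2, 1:] m)"
    using minsmc_alg_correct unfolding Let_def by metis
qed

end
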